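(* Let $N\ge 1$, $T\ge 1$ and $1\le S\le T$ be integers. The matrix $P^S_{S\mapsto S-1}$ with rows indexed by $\Omega(N,T,S)$ and columns indexed by $\Omega(N,T,S-1)$ (defined in the context) is stochastic, i.e. its entries are nonnegative and $\sum_{Y\in\Omega(N,T,S-1)}P^S_{S\mapsto S-1}(X,Y)=1$ for every $X\in\Omega(N,T,S)$. Moreover it maps the uniform measure to the uniform measure: for every $Y\in\Omega(N,T,S-1)$, $$\mu(N,T,S-1)(Y)=\sum_{X\in\Omega(N,T,S)}P^S_{S\mapsto S-1}(X,Y)\,\mu(N,T,S)(X).$$
   Context: Fix integers $N\ge1$, $T\ge1$. For an integer $0\le S\le T$, $\Omega(N,T,S)$ is the set of families of $N$ non-intersecting lattice paths $\tau_1,\dots,\tau_N:\{0,1,\dots,T\}\to\mathbb Z$ with $\tau_i(0)=i-1$, $\tau_i(T)=S+i-1$, $\tau_i(t+1)-\tau_i(t)\in\{0,1\}$ and $\tau_1(t)<\dots<\tau_N(t)$ for all $t$. Such a family is identified with the sequence $X=(X(0),X(1),\dots,X(T))$, $X(t)=(\tau_1(t),\dots,\tau_N(t))$. $\mu(N,T,S)$ is the uniform probability measure on $\Omega(N,T,S)$. For $0\le S,t\le T$ put $$\mathfrak X^{S,t}=\{x\in\mathbb Z:\max(0,t+S-T)\le x\le\min(t+N-1,S+N-1)\},$$ $$\mathcal X^{S,t}=\{(x_1,\dots,x_N)\in(\mathfrak X^{S,t})^N: x_1<\dots<x_N\};$$ then $X(t)\in\mathcal X^{S,t}$ for $X\in\Omega(N,T,S)$.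 $(a)_k=a(a+1)\cdots(a+k-1)$. Matrix $P^{S,t}_{t+}$ ($0\le t\le T-1$), of size $|\mathcal X^{S,t}|\times|\mathcal X^{S,t+1}|$: $$P^{S,t}_{t+}(X,Y)=\frac{\prod_{i<j}(y_j-y_i)\prod_{i:y_i=x_i+1}(N+S-x_i-1)\prod_{i:y_i=x_i}(x_i+T-t-S)}{(T-t)_N\prod_{i<j}(x_j-x_i)}$$ if $y_i-x_i\in\{0,1\}$ for all $i$, and $0$ otherwise. Matrix $P^{S,t}_{S+}$ ($0\le S\le T-1$), of size $|\mathcal X^{S,t}|\times|\mathcal X^{S+1,t}|$: $$P^{S,t}_{S+}(X,Y)=\frac{\prod_{i<j}(y_j-y_i)\prod_{i:y_i=x_i+1}(N+t-x_i-1)\prod_{i:y_i=x_i}(x_i+T-t-S)}{(T-S)_N\prod_{i<j}(x_j-x_i)}$$ if $y_i-x_i\in\{0,1\}$ for all $i$, and $0$ otherwise. For $1\le S\le T$, $X\in\Omega(N,T,S)$, $Y\in\Omega(N,T,S-1)$ define $$P^S_{S\mapsto S-1}(X,Y)=\prod_{t=0}^{T-1}\frac{P^{S-1,t}_{t+}(Y(t),Y(t+1))\,P^{S-1,t+1}_{S+}(Y(t+1),X(t+1))}{(P^{S-1,t}_{t+}P^{S-1,t+1}_{S+})(Y(t),X(t+1))}$$ if $\prod_{t=0}^{T-1}(P^{S-1,t}_{t+}P^{S-1,t+1}_{S+})(Y(t),X(t+1))>0$, and $P^S_{S\mapsto S-1}(X,Y)=0$ otherwise. (Juxtaposition of matrices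 is the matrix product.) *)

theory Defs
  imports "HOL-Probability.Probability"
begin

text \<open>
  An \<open>N\<close>-point configuration \<open>(x\<^sub>1, \<dots>, x\<^sub>N)\<close> is a function in \<open>{1..N} \<rightarrow>\<^sub>E UNIV\<close>. A family of
  paths is represented by the sequence \<open>X = (X(0), \<dots>, X(T))\<close> of its time slices, so that
  \<open>X t i\<close> is \<open>\<tau>\<^sub>i(t)\<close>. Extensionality (\<open>\<rightarrow>\<^sub>E\<close>) makes equality of configurations and of
  families agree with equality on the intended index ranges.
\<close>

type_synonym config = "nat \<Rightarrow> int"
type_synonym family = "nat \<Rightarrow> config"

definition Omega :: "nat \<Rightarrow> nat \<Rightarrow> nat \<Rightarrow> family set" where
  "Omega N T S = {X \<in> {0..T} \<rightarrow>\<^sub>E ({1..N} \<rightarrow>\<^sub>E UNIV).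
     (\<forall>i\<in>{1..N}. X 0 i = int i - 1) \<and>
     (\<forall>i\<in>{1..N}. X T i = int S + int i - 1) \<and>
     (\<forall>i\<in>{1..N}. \<forall>t\<in>{0..<T}. X (t + 1) i - X t i \<in> {0, 1}) \<and>
     (\<forall>t\<in>{0..T}. strict_mono_on {1..N} (X t))}"

definition mu :: "nat \<Rightarrow> nat \<Rightarrow> nat \<Rightarrow> family pmf" where
  "mu N T S = pmf_of_set (Omega N T S)"

definition sites :: "nat \<Rightarrow> nat \<Rightarrow> nat \<Rightarrow> nat \<Rightarrow> int set" where
  "sites N T S t =
     {max 0 (int t + int S - int T) .. min (int t + int N - 1) (int S + int N - 1)}"

definition configs :: "nat \<Rightarrow> nat \<Rightarrow> nat \<Rightarrow> nat \<Rightarrow> config set" where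
  "configs N T S t = {X \<in> {1..N} \<rightarrow>\<^sub>E sites N T S t. strict_mono_on {1..N} X}"

definition vandermonde :: "nat \<Rightarrow> config \<Rightarrow> real" where
  "vandermonde N X = (\<Prod>j\<in>{1..N}. \<Prod>i\<in>{1..<j}. real_of_int (X j - X i))"

text \<open>
  A matrix is a function of a row and a column index; only its values on the intended index
  sets are meaningful. The rows of \<open>P_t_plus N T S t\<close> and of \<open>P_S_plus N T S t\<close> are
  indexed by \<open>configs N T S t\<close>, their columns by \<open>configs N T S (t + 1)\<close> and
  \<open>configs N T (S + 1) t\<close> respectively.
\<close>

definition P_t_plus :: "nat \<Rightarrow> nat \<Rightarrow> nat \<Rightarrow> nat \<Rightarrow> config \<Rightarrow> config \<Rightarrow> real" where
  "P_t_plus N T S t X Y =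
     (if \<forall>i\<in>{1..N}. Y i - X i \<in> {0, 1} then
        vandermonde N Y
        * (\<Prod>i\<in>{i\<in>{1..N}. Y i = X i + 1}. real_of_int (int N + int S - X i - 1))
        * (\<Prod>i\<in>{i\<in>{1..N}. Y i = X i}. real_of_int (X i + int T - int t - int S))
        / (pochhammer (real T - real t) N * vandermonde N X)
      else 0)"

definition P_S_plus :: "nat \<Rightarrow> nat \<Rightarrow> nat \<Rightarrow> nat \<Rightarrow> config \<Rightarrow> config \<Rightarrow> real" where
  "P_S_plus N T S t X Y =
     (if \<forall>i\<in>{1..N}. Y i - X i \<in> {0, 1} then
        vandermonde N Y
        * (\<Prod>i\<in>{i\<in>{1..N}. Y i = X i + 1}. real_of_int (int N + int t - X i - 1))
        * (\<Prod>i\<in>{i\<in>{1..N}. Y i = X i}. real_of_int (X i + int T - int t - int S))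
        / (pochhammer (real T - real S) N * vandermonde N X)
      else 0)"

text \<open>\<open>I\<close> is the common index set of the columns of \<open>P\<close> and the rows of \<open>Q\<close>.\<close>

definition matrix_prod ::
    "'b set \<Rightarrow> ('a \<Rightarrow> 'b \<Rightarrow> real) \<Rightarrow> ('b \<Rightarrow> 'c \<Rightarrow> real) \<Rightarrow> 'a \<Rightarrow> 'c \<Rightarrow> real" where
  "matrix_prod I P Q x z = (\<Sum>y\<in>I. P x y * Q y z)"

text \<open>The product \<open>P\<^sub>t\<^sub>+ P\<^sub>S\<^sub>+\<close> at \<open>(S, t)\<close>, from \<open>configs N T S t\<close> to \<open>configs N T (S + 1) (t + 1)\<close>.\<close>

definition P_tS :: "nat \<Rightarrow> nat \<Rightarrow> nat \<Rightarrow> nat \<Rightarrow> config \<Rightarrow> config \<Rightarrow> real" where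
  "P_tS N T S t =
     matrix_prod (configs N T S (t + 1)) (P_t_plus N T S t) (P_S_plus N T S (t + 1))"

text \<open>Only meaningful for \<open>S \<ge> 1\<close>; rows in \<open>Omega N T S\<close>, columns in \<open>Omega N T (S - 1)\<close>.\<close>

definition P_down :: "nat \<Rightarrow> nat \<Rightarrow> nat \<Rightarrow> family \<Rightarrow> family \<Rightarrow> real" where
  "P_down N T S X Y =
     (if (\<Prod>t\<in>{0..<T}. P_tS N T (S - 1) t (Y t) (X (t + 1))) > 0 then
        (\<Prod>t\<in>{0..<T}.
           P_t_plus N T (S - 1) t (Y t) (Y (t + 1))
           * P_S_plus N T (S - 1) (t + 1) (Y (t + 1)) (X (t + 1))
           / P_tS N T (S - 1) t (Y t) (X (t + 1)))
      else 0)"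

definition stochastic :: "'a set \<Rightarrow> 'b set \<Rightarrow> ('a \<Rightarrow> 'b \<Rightarrow> real) \<Rightarrow> bool" where
  "stochastic A B P \<longleftrightarrow>
     (\<forall>x\<in>A. \<forall>y\<in>B. 0 \<le> P x y) \<and> (\<forall>x\<in>A. (\<Sum>y\<in>B. P x y) = 1)"

end

theory Submission imports Defs begin

text \<open>
  Up to exchanging \<open>S\<close> and \<open>t\<close>, the two one-step kernels are the same. Everything rests on their
  commutation: the two orders of composition give the same two-step kernel. After the Vandermonde
  factors telescope, this is an identity between sums over non-intersecting intermediate
  configurations, proved by adding one particle at a time; only for particles packed into a block
  do the two orders differ, and there a linear relation between the two partial sums persists.

  Commutation shows that, for fixed \<open>X\<close>, the denominators of \<open>P_down\<close> stay positive along the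
  sequential choice of \<open>Y(1), Y(2), \<dots>\<close>, so that the rows sum to one. The product of the
  \<open>P_t_plus\<close> along a family has the same value on all of \<open>Omega N T S\<close>; weighting \<open>P_down\<close> by it and
  commuting turns the sum over \<open>X\<close> into a product of conditional laws, so all column sums
  coincide, which for a stochastic matrix means that uniform goes to uniform.
\<close>

subsection \<open>Sums over paths\<close>

lemma sum_PiE_insert:
  assumes "a \<notin> A"
  shows "(\<Sum>f\<in>PiE (insert a A) B. h f) = (\<Sum>b\<in>B a. \<Sum>f\<in>PiE A B. h (f(a := b)))"
proof -
  have "(\<Sum>f\<in>PiE (insert a A) B. h f) = (\<Sum>(b, f)\<in>B a \<times> PiE A B. h (f(a := b)))"
    unfolding PiE_insert_eq using inj_combinator[OF assms, of B]
    by (subst sum.reindex) (auto simp: case_prod_unfold)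
  then show ?thesis
    by (simp add: sum.cartesian_product)
qed

text \<open>The last slice occurs in the last factor only, so summing it out first yields 1. After
  \<open>n\<close> rounds just the free choice of the starting slice remains.\<close>

lemma sum_paths_forward:
  fixes q :: "nat \<Rightarrow> 'a \<Rightarrow> 'a \<Rightarrow> real"
  assumes "\<And>t a. t < n \<Longrightarrow> a \<in> G t \<Longrightarrow> (\<Sum>b\<in>G (Suc t). q t a b) = 1"
  shows "(\<Sum>Y\<in>PiE {0..n} G. \<Prod>t<n. q t (Y t) (Y (Suc t))) = card (G 0)"
  using assms
proof (induction n)
  case 0
  have "(\<Sum>Y\<in>PiE {0} G. 1 :: real) = card (G 0)"
    by (subst sum_PiE_insert) simp_all
  then show ?case by simp
next
  case (Suc n)
  have "(\<Sum>Y\<in>PiE {0..Suc n} G. \<Prod>t<Suc n. q t (Y t) (Y (Suc t)))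
      = (\<Sum>b\<in>G (Suc n). \<Sum>Y\<in>PiE {0..n} G.
           (\<Prod>t<n. q t (Y t) (Y (Suc t))) * q n (Y n) b)"
    by (simp add: atLeast0_atMost_Suc sum_PiE_insert)
  also have "\<dots> = (\<Sum>Y\<in>PiE {0..n} G.
      (\<Prod>t<n. q t (Y t) (Y (Suc t))) * (\<Sum>b\<in>G (Suc n). q n (Y n) b))"
    by (subst sum.swap) (simp add: sum_distrib_left)
  also have "\<dots> = (\<Sum>Y\<in>PiE {0..n} G. \<Prod>t<n. q t (Y t) (Y (Suc t)))"
    by (intro sum.cong) (auto simp: Suc.prems PiE_mem)
  finally show ?case using Suc by simp
qed

text \<open>Here the column sums are one, so the first slice should be summed out first, while the
  induction peels off the last index. Generalising over \<open>g\<close>, which absorbs the last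
  factor, reconciles the two.\<close>

lemma sum_paths_backward:
  fixes r :: "nat \<Rightarrow> 'a \<Rightarrow> 'a \<Rightarrow> real"
  assumes "\<And>t b. t < n \<Longrightarrow> b \<in> H (Suc t) \<Longrightarrow> (\<Sum>a\<in>H t. r t a b) = 1"
  shows "(\<Sum>X\<in>PiE {0..n} H. (\<Prod>t<n. r t (X t) (X (Suc t))) * g (X n)) = (\<Sum>b\<in>H n. g b)"
  using assms
proof (induction n arbitrary: g)
  case 0
  then show ?case by (simp add: sum_PiE_insert)
next
  case (Suc n)
  have "(\<Sum>X\<in>PiE {0..Suc n} H. (\<Prod>t<Suc n. r t (X t) (X (Suc t))) * g (X (Suc n)))
      = (\<Sum>b\<in>H (Suc n). \<Sum>X\<in>PiE {0..n} H.
           (\<Prod>t<n. r t (X t) (X (Suc t))) * (r n (X n) b * g b))"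
    by (simp add: atLeast0_atMost_Suc sum_PiE_insert mult.assoc)
  also have "\<dots> = (\<Sum>b\<in>H (Suc n). (\<Sum>a\<in>H n. r n a b * g b))"
    by (intro sum.cong refl Suc.IH Suc.prems) auto
  also have "\<dots> = (\<Sum>b\<in>H (Suc n). (\<Sum>a\<in>H n. r n a b) * g b)"
    by (simp add: sum_distrib_right)
  also have "\<dots> = (\<Sum>b\<in>H (Suc n). g b)"
    by (intro sum.cong) (auto simp: Suc.prems)
  finally show ?case .
qed

subsection \<open>The one-step kernels\<close>

lemma sites_commute: "sites N T S t = sites N T t S"
  by (simp add: sites_def add.commute min.commute)

lemma configs_commute: "configs N T S t = configs N T t S"
  by (simp add: configs_def sites_commute)

lemma finite_configs: "finite (configs N T S t)"
  by (rule finite_subset[of _ "{1..N} \<rightarrow>\<^sub>E sites N T S t"])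
     (auto simp: configs_def sites_def intro!: finite_PiE)

lemma vandermonde_pos:
  assumes "strict_mono_on {1..N} X"
  shows "vandermonde N X > 0"
  unfolding vandermonde_def
  by (intro prod_pos) (use assms in \<open>auto simp: strict_mono_on_def\<close>)

lemma P_S_plus_eq_P_t_plus: "P_S_plus N T S t = P_t_plus N T t S"
proof -
  have "x + int T - int t - int S = x + int T - int S - int t" for x
    by simp
  then show ?thesis
    unfolding P_S_plus_def P_t_plus_def by presburger
qed

lemma P_tS_eq:
  "P_tS N T S t X Z = (\<Sum>Y\<in>configs N T S (t + 1). P_t_plus N T S t X Y * P_t_plus N T (t + 1) S Y Z)"
  by (simp add: P_tS_def matrix_prod_def P_S_plus_eq_P_t_plus)

text \<open>The default 0 for illegal jumps absorbs the case distinction of \<open>P_t_plus\<close>.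
  The kernel becomes a Doob transform, by the Vandermonde determinant, of a product over independent
  particles.\<close>

definition step_wt :: "nat \<Rightarrow> nat \<Rightarrow> nat \<Rightarrow> nat \<Rightarrow> int \<Rightarrow> int \<Rightarrow> real" where
  "step_wt N T S t x y =
     (if y = x + 1 then real_of_int (int N + int S - x - 1)
      else if y = x then real_of_int (x + int T - int t - int S) else 0)"

lemma P_t_plus_eq:
  "P_t_plus N T S t X Y =
     vandermonde N Y / (pochhammer (real T - real t) N * vandermonde N X)
       * (\<Prod>i\<in>{1..N}. step_wt N T S t (X i) (Y i))"
proof (cases "\<forall>i\<in>{1..N}. Y i - X i \<in> {0, 1}")
  case True
  have "(\<Prod>i\<in>{1..N}. step_wt N T S t (X i) (Y i))
      = (\<Prod>i\<in>{1..N}. if Y i = X i + 1 then real_of_int (int N + int S - X i - 1)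
           else real_of_int (X i + int T - int t - int S))"
    using True by (intro prod.cong) (auto simp: step_wt_def)
  also have "\<dots> = (\<Prod>i\<in>{i\<in>{1..N}. Y i = X i + 1}. real_of_int (int N + int S - X i - 1))
      * (\<Prod>i\<in>{i\<in>{1..N}. Y i \<noteq> X i + 1}. real_of_int (X i + int T - int t - int S))"
    by (subst prod.If_cases) (auto simp: Int_def)
  also have "{i\<in>{1..N}. Y i \<noteq> X i + 1} = {i\<in>{1..N}. Y i = X i}"
    using True by force
  finally show ?thesis
    using True by (simp add: P_t_plus_def)
next
  case False
  then obtain i where "i \<in> {1..N}" "Y i \<noteq> X i + 1" "Y i \<noteq> X i" by force
  then have "(\<Prod>i\<in>{1..N}. step_wt N T S t (X i) (Y i)) = 0"
    by (intro prod_zero) (auto simp: step_wt_def)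
  then show ?thesis using False by (simp only: P_t_plus_def if_False mult_zero_right)
qed

lemma step_wt_pos:
  assumes "x \<in> sites N T S t" "y \<in> sites N T S (Suc t)" "y - x \<in> {0, 1}"
  shows "step_wt N T S t x y > 0"
  using assms by (auto simp: step_wt_def sites_def)

text \<open>The up-weight vanishes at \<open>N + S - 1\<close> and the flat weight at
  \<open>t + S - T\<close>, the only sites from which a legal jump can leave the window. Sums over
  slices may therefore ignore the window.\<close>

lemma step_wt_leaves_sites:
  assumes "x \<in> sites N T S t" "y \<notin> sites N T S (Suc t)"
  shows "step_wt N T S t x y = 0"
  using assms by (auto simp: step_wt_def sites_def)

lemma step_wt_nonneg:
  assumes "x \<in> sites N T S t" "y \<in> sites N T S (Suc t)"
  shows "step_wt N T S t x y \<ge> 0"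
  using assms by (auto simp: step_wt_def sites_def)

lemma P_t_plus_nonneg:
  assumes "t < T" "X \<in> configs N T S t" "Y \<in> configs N T S (Suc t)"
  shows "P_t_plus N T S t X Y \<ge> 0"
  using assms vandermonde_pos[of N X] vandermonde_pos[of N Y]
  unfolding P_t_plus_eq configs_def
  by (intro mult_nonneg_nonneg prod_nonneg divide_nonneg_nonneg step_wt_nonneg
        pochhammer_nonneg ballI) (auto simp: less_imp_le)

lemma P_t_plus_pos_iff:
  assumes "t < T" "X \<in> configs N T S t" "Y \<in> configs N T S (Suc t)"
  shows "P_t_plus N T S t X Y > 0 \<longleftrightarrow> (\<forall>i\<in>{1..N}. Y i - X i \<in> {0, 1})"
proof
  assume "\<forall>i\<in>{1..N}. Y i - X i \<in> {0, 1}"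
  then show "P_t_plus N T S t X Y > 0"
    using assms vandermonde_pos[of N X] vandermonde_pos[of N Y]
    unfolding P_t_plus_eq configs_def
    by (intro mult_pos_pos prod_pos divide_pos_pos step_wt_pos pochhammer_pos ballI) auto
qed (auto simp: P_t_plus_def split: if_splits)

subsection \<open>Commutation of the kernels\<close>

text \<open>A newly added particle is constrained only by its left neighbour, so a test function
  \<open>g\<close> of the last position is all the memory that a recursion on \<open>n\<close>
  requires.\<close>

definition transfer ::
  "(nat \<Rightarrow> int \<Rightarrow> real) \<Rightarrow> config \<Rightarrow> nat \<Rightarrow> (int \<Rightarrow> real) \<Rightarrow> real" where
  "transfer w X n g = (\<Sum>Y\<in>PiE {1..n} (\<lambda>i. {X i, X i + 1}).
     (\<Prod>i\<in>{1..n}. w i (Y i)) * of_bool (strict_mono_on {1..n} Y) * g (Y n))"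

text \<open>The last particle has two possible positions, so two numbers determine
  \<open>transfer\<close> as a linear functional of \<open>g\<close>.\<close>

lemma transfer_split:
  assumes "1 \<le> n"
  shows "transfer w X n g =
    transfer w X n (\<lambda>y. of_bool (y = X n)) * g (X n)
    + transfer w X n (\<lambda>y. of_bool (y = X n + 1)) * g (X n + 1)"
  unfolding transfer_def sum_distrib_right sum.distrib[symmetric]
proof (intro sum.cong refl)
  fix Y assume "Y \<in> PiE {1..n} (\<lambda>i. {X i, X i + 1})"
  then have "Y n \<in> {X n, X n + 1}" using assms by (auto simp: PiE_def Pi_def)
  then show "(\<Prod>i\<in>{1..n}. w i (Y i)) * of_bool (strict_mono_on {1..n} Y) * g (Y n) =
    (\<Prod>i\<in>{1..n}. w i (Y i)) * of_bool (strict_mono_on {1..n} Y) * of_bool (Y n = X n) * g (X n)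
    + (\<Prod>i\<in>{1..n}. w i (Y i)) * of_bool (strict_mono_on {1..n} Y) * of_bool (Y n = X n + 1) * g (X n + 1)"
    by auto
qed

lemma strict_mono_on_Suc_iff:
  fixes Y :: "nat \<Rightarrow> 'a::order"
  assumes "1 \<le> n"
  shows "strict_mono_on {1..Suc n} Y \<longleftrightarrow> strict_mono_on {1..n} Y \<and> Y n < Y (Suc n)"
proof
  assume "strict_mono_on {1..n} Y \<and> Y n < Y (Suc n)"
  then have mono: "\<And>i j. 1 \<le> i \<Longrightarrow> i < j \<Longrightarrow> j \<le> n \<Longrightarrow> Y i < Y j"
    and last: "Y n < Y (Suc n)"
    by (auto simp: strict_mono_on_def)
  show "strict_mono_on {1..Suc n} Y"
  proof (rule strict_mono_onI)
    fix i j assume "i \<in> {1..Suc n}" "j \<in> {1..Suc n}" "i < j"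
    then show "Y i < Y j"
      using mono[of i j] mono[of i n] last by (cases "j = Suc n"; cases "i = n") auto
  qed
qed (use assms in \<open>auto simp: strict_mono_on_def\<close>)

lemma transfer_1: "transfer w X 1 g = w 1 (X 1) * g (X 1) + w 1 (X 1 + 1) * g (X 1 + 1)"
proof -
  have "transfer w X 1 g = (\<Sum>Y\<in>PiE (insert 1 {}) (\<lambda>i. {X i, X i + 1}). w 1 (Y 1) * g (Y 1))"
    unfolding transfer_def by (intro sum.cong) (auto simp: strict_mono_on_def)
  also have "\<dots> = w 1 (X 1) * g (X 1) + w 1 (X 1 + 1) * g (X 1 + 1)"
    by (subst sum_PiE_insert) auto
  finally show ?thesis .
qed

lemma transfer_Suc:
  assumes "1 \<le> n"
  shows "transfer w X (Suc n) g =
    (\<Sum>y\<in>{X (Suc n), X (Suc n) + 1}. transfer w X n (\<lambda>x. of_bool (x < y)) * w (Suc n) y * g y)"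
proof -
  have "transfer w X (Suc n) g =
    (\<Sum>y\<in>{X (Suc n), X (Suc n) + 1}. \<Sum>Y\<in>PiE {1..n} (\<lambda>i. {X i, X i + 1}).
      (\<Prod>i\<in>{1..n}. w i (Y i)) * of_bool (strict_mono_on {1..n} Y) * of_bool (Y n < y)
        * w (Suc n) y * g y)"
    unfolding transfer_def atLeastAtMostSuc_conv[OF le_SucI[OF assms]]
  proof (subst sum_PiE_insert, simp, intro sum.cong refl)
    fix y and Y :: config
    let ?Y = "Y(Suc n := y)"
    have "strict_mono_on {1..n} ?Y = strict_mono_on {1..n} Y"
      by (auto simp: strict_mono_on_def)
    then have "strict_mono_on (insert (Suc n) {1..n}) ?Y \<longleftrightarrow> strict_mono_on {1..n} Y \<and> Y n < y"
      using strict_mono_on_Suc_iff[OF assms, of ?Y]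
      by (simp add: atLeastAtMostSuc_conv)
    moreover have "(\<Prod>i\<in>insert (Suc n) {1..n}. w i (?Y i)) = w (Suc n) y * (\<Prod>i\<in>{1..n}. w i (Y i))"
      by simp
    ultimately show "(\<Prod>i\<in>insert (Suc n) {1..n}. w i (?Y i))
        * of_bool (strict_mono_on (insert (Suc n) {1..n}) ?Y) * g (?Y (Suc n))
      = (\<Prod>i\<in>{1..n}. w i (Y i)) * of_bool (strict_mono_on {1..n} Y) * of_bool (Y n < y)
        * w (Suc n) y * g y"
      by simp
  qed
  then show ?thesis
    by (simp only: transfer_def sum_distrib_right)
qed

section \<open>One particle making one step of each kind\<close>

definition two_step_wt :: "nat \<Rightarrow> nat \<Rightarrow> nat \<Rightarrow> nat \<Rightarrow> int \<Rightarrow> int \<Rightarrow> int \<Rightarrow> real" where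
  "two_step_wt N T S t x y z = step_wt N T S t x y * step_wt N T (Suc t) S y z"

lemma two_step_wt_stay:
  "two_step_wt N T S t x x z =
     (if z = x then (x + T - t - S) * (x + T - t - S - 1)
      else if z = x + 1 then (x + T - t - S) * (int N + t - x) else 0)"
  by (simp add: two_step_wt_def step_wt_def)

lemma two_step_wt_up:
  "two_step_wt N T S t x (x + 1) z =
     (if z = x + 1 then (int N + S - x - 1) * (x + T - t - S)
      else if z = x + 2 then (int N + S - x - 1) * (int N + t - x - 1) else 0)"
  by (simp add: two_step_wt_def step_wt_def)

text \<open>This is commutation for a single particle. Both routes contribute only for
  \<open>z = x + 1\<close>, where the factors \<open>N + t - x\<close> and
  \<open>N + S - x - 1\<close> have a sum symmetric in \<open>S\<close> and
  \<open>t\<close>.\<close>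

lemma two_step_wt_total_commute:
  "two_step_wt N T S t x x z + two_step_wt N T S t x (x + 1) z
   = two_step_wt N T t S x x z + two_step_wt N T t S x (x + 1) z"
  unfolding two_step_wt_stay two_step_wt_up by (simp add: algebra_simps)

text \<open>Without exclusion the sum would factor into single-particle sums, which commute. The
  induction on the number of particles follows the parts of the sum where the last intermediate
  particle stays (\<open>l\<close>) or has moved (\<open>u\<close>).\<close>

lemma transfer_commute:
  fixes N T S t :: nat and X Z :: config
  defines "w \<equiv> \<lambda>S t i y. two_step_wt N T S t (X i) y (Z i)"
  assumes "strict_mono_on {1..n} X" "strict_mono_on {1..n} Z" "1 \<le> n"
  shows "transfer (w S t) X n (\<lambda>_. 1) = transfer (w t S) X n (\<lambda>_. 1)"
proof -
  define l where "l S t k = transfer (w S t) X k (\<lambda>y. of_bool (y = X k))" for S t k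
  define u where "u S t k = transfer (w S t) X k (\<lambda>y. of_bool (y = X k + 1))" for S t k
  have total: "transfer (w S t) X k (\<lambda>_. 1) = l S t k + u S t k" if "1 \<le> k" for S t k
    using transfer_split[OF that, of "w S t" X "\<lambda>_. 1"] by (simp add: l_def u_def)
  \<comment> \<open>Moving is never blocked by the left neighbour; staying is blocked exactly when
    that neighbour has moved onto the same site.\<close>
  have lu_Suc: "l S t (Suc k) = (l S t k + of_bool (X k + 1 < X (Suc k)) * u S t k) * w S t (Suc k) (X (Suc k))"
      "u S t (Suc k) = (l S t k + u S t k) * w S t (Suc k) (X (Suc k) + 1)"
    if "1 \<le> k" "X k < X (Suc k)" for S t k
    using that unfolding l_def u_def
    by (simp_all add: transfer_Suc transfer_split[where g = "\<lambda>x. of_bool (x < _)"])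
  \<comment> \<open>With \<open>A = N + t - X k - 1\<close>, \<open>B = N + S - X k - 1\<close>, the last clause is the closed form
    \<open>(A - B) * total = A * l - B * l'\<close> behind the symmetry in \<open>A, B\<close> of the sum over a block of
    consecutive sites, where only \<open>stay \<dots> stay, move \<dots> move\<close> is possible.\<close>
  define inv where "inv k \<longleftrightarrow> l S t k + u S t k = l t S k + u t S k
    \<and> (Z k \<le> X k \<longrightarrow> u S t k = 0 \<and> u t S k = 0)
    \<and> (Z k = X k + 1 \<longrightarrow> l S t k * (int N + t - X k - 1) - l t S k * (int N + S - X k - 1)
         = (real t - real S) * (l S t k + u S t k))" for k
  \<comment> \<open>A prefactor \<open>p\<close> common to both orders means that the earlier
    particles do not interfere, so the invariant reduces to single-particle identities.\<close>
  have fresh: "inv k" if "l S t k = p * w S t k (X k)" "u S t k = p * w S t k (X k + 1)"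
      "l t S k = p * w t S k (X k)" "u t S k = p * w t S k (X k + 1)" for k p
    unfolding inv_def
  proof (intro conjI impI)
    have "p * (w S t k (X k) + w S t k (X k + 1)) = p * (w t S k (X k) + w t S k (X k + 1))"
      using two_step_wt_total_commute[of N T S t "X k" "Z k"] by (simp add: w_def)
    then show "l S t k + u S t k = l t S k + u t S k"
      by (simp add: that algebra_simps)
  next
    assume "Z k = X k + 1"
    then show "l S t k * (int N + t - X k - 1) - l t S k * (int N + S - X k - 1)
         = (real t - real S) * (l S t k + u S t k)"
      by (simp add: that w_def two_step_wt_stay two_step_wt_up) (simp add: algebra_simps)
  qed (simp_all add: that w_def two_step_wt_up)
  have "inv k" if "1 \<le> k" "k \<le> n" for k
    using that
  proof (induction k rule: dec_induct)
    case base
    show ?case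
      by (rule fresh[where p = 1]) (simp_all add: l_def u_def transfer_1[unfolded One_nat_def])
  next
    case (step k)
    then have X: "X k < X (Suc k)" and Z: "Z k < Z (Suc k)" and IH: "inv k"
      using assms(2,3) by (auto simp: strict_mono_on_def)
    note rec = lu_Suc[OF \<open>1 \<le> k\<close> X]
    have tot: "l S t k + u S t k = l t S k + u t S k"
      using IH by (simp add: inv_def)
    \<comment> \<open>Exclusion distinguishes the two orders only for adjacent particles that both
      have net displacement 1. In all other cases the new particle is effectively free.\<close>
    show ?case
    proof (cases "X (Suc k) = X k + 1 \<and> Z k = X k + 1 \<and> Z (Suc k) = X (Suc k) + 1")
      case False
      have "l S' t' (Suc k) = (l S' t' k + u S' t' k) * w S' t' (Suc k) (X (Suc k))"
        if "S' = S \<and> t' = t \<or> S' = t \<and> t' = S" for S' t'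
      proof (cases "X (Suc k) = X k + 1")
        case True
        show ?thesis
        proof (cases "Z k \<le> X k")
          case True
          then have "u S' t' k = 0" using IH that by (auto simp: inv_def)
          then show ?thesis by (simp add: rec)
        next
          case False
          \<comment> \<open>Here \<open>Z (Suc k)\<close> is at least \<open>X (Suc k) + 2\<close>,
            out of reach once the first step is flat.\<close>
          then have "w S' t' (Suc k) (X (Suc k)) = 0"
            using Z True \<open>\<not> (X (Suc k) = X k + 1 \<and> Z k = X k + 1 \<and> Z (Suc k) = X (Suc k) + 1)\<close>
            by (auto simp: w_def two_step_wt_stay)
          then show ?thesis by (simp add: rec)
        qed
      qed (use X in \<open>simp add: rec\<close>)
      then show ?thesis
        by (intro fresh[where p = "l S t k + u S t k"]) (simp_all add: rec(2) tot)
    next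
      case True
      \<comment> \<open>Adjacency makes \<open>a\<close> and \<open>b\<close> the constants of the
        old invariant; those of the new one are \<open>a - 1\<close> and \<open>b - 1\<close>. The
        factor \<open>c\<close> is the flat weight shared by both orders.\<close>
      define a where "a = real N + t - X (Suc k)"
      define b where "b = real N + S - X (Suc k)"
      define c where "c = X (Suc k) + real T - t - S"
      define p where "p = l S t k + u S t k"
      have ab: "real t - real S = a - b" by (simp add: a_def b_def diff_diff_eq)
      have "l S t k * (int N + t - X k - 1) - l t S k * (int N + S - X k - 1) = (real t - real S) * p"
        using IH True unfolding inv_def p_def by blast
      then have IH': "l S t k * a - l t S k * b = (a - b) * p"
        using True unfolding ab by (simp add: a_def b_def diff_diff_eq)
      have new: "l S t (Suc k) = l S t k * (c * a)" "u S t (Suc k) = p * ((b - 1) * c)"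
        "l t S (Suc k) = l t S k * (c * b)" "u t S (Suc k) = p * ((a - 1) * c)"
        using True two_step_wt_stay[of N T _ _ "X (Suc k)" "Z (Suc k)"]
          two_step_wt_up[of N T _ _ "X (Suc k)" "Z (Suc k)"]
        by (simp_all add: rec w_def p_def tot a_def b_def c_def)
      \<comment> \<open>Equality of the new totals is exactly \<open>IH'\<close> multiplied by
        \<open>c\<close>, which is why the invariant carries that relation.\<close>
      have "l S t (Suc k) + u S t (Suc k) = l t S (Suc k) + u t S (Suc k)"
        unfolding new using IH' by algebra
      moreover have "l S t (Suc k) * (a - 1) - l t S (Suc k) * (b - 1)
          = (a - b) * (l S t (Suc k) + u S t (Suc k))"
        unfolding new using IH' by algebra
      ultimately show ?thesis
        using True by (simp add: inv_def ab) (simp add: a_def b_def algebra_simps)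
    qed
  qed
  then show ?thesis
    using assms(4) by (simp add: total inv_def)
qed

text \<open>The two index sets differ by zero terms only: illegal jumps and exits from the window
  have weight 0, and the indicator removes collisions.\<close>

lemma sum_configs_eq_transfer:
  assumes "X \<in> configs N T S t"
  shows "(\<Sum>Y\<in>configs N T S (Suc t). \<Prod>i\<in>{1..N}. two_step_wt N T S t (X i) (Y i) (Z i))
    = transfer (\<lambda>i y. two_step_wt N T S t (X i) y (Z i)) X N (\<lambda>_. 1)"
  unfolding transfer_def
proof (rule sum.mono_neutral_cong)
  fix Y assume "Y \<in> PiE {1..N} (\<lambda>i. {X i, X i + 1}) - configs N T S (Suc t)"
  then consider "\<not> strict_mono_on {1..N} Y" | i where "i \<in> {1..N}" "Y i \<notin> sites N T S (Suc t)"
    by (auto simp: configs_def PiE_def Pi_def)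
  then have "\<not> strict_mono_on {1..N} Y
      \<or> (\<Prod>i\<in>{1..N}. two_step_wt N T S t (X i) (Y i) (Z i)) = 0"
  proof cases
    case (2 i)
    moreover have "X i \<in> sites N T S t"
      using assms 2 by (auto simp: configs_def)
    ultimately have "two_step_wt N T S t (X i) (Y i) (Z i) = 0"
      by (simp add: two_step_wt_def step_wt_leaves_sites)
    then show ?thesis
      using 2 by (intro disjI2 prod_zero) auto
  qed simp
  then show "(\<Prod>i\<in>{1..N}. two_step_wt N T S t (X i) (Y i) (Z i))
      * of_bool (strict_mono_on {1..N} Y) * 1 = 0"
    by auto
next
  fix Y assume "Y \<in> configs N T S (Suc t) - PiE {1..N} (\<lambda>i. {X i, X i + 1})"
  then obtain i where "i \<in> {1..N}" "Y i \<noteq> X i" "Y i \<noteq> X i + 1"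
    by (auto simp: configs_def PiE_def Pi_def)
  then show "(\<Prod>i\<in>{1..N}. two_step_wt N T S t (X i) (Y i) (Z i)) = 0"
    by (intro prod_zero) (auto simp: two_step_wt_def step_wt_def)
next
  fix Y assume "Y \<in> configs N T S (Suc t) \<inter> PiE {1..N} (\<lambda>i. {X i, X i + 1})"
  then show "(\<Prod>i\<in>{1..N}. two_step_wt N T S t (X i) (Y i) (Z i))
    = (\<Prod>i\<in>{1..N}. two_step_wt N T S t (X i) (Y i) (Z i))
      * of_bool (strict_mono_on {1..N} Y) * 1"
    by (simp add: configs_def)
qed (auto intro!: finite_PiE finite_configs)

text \<open>The Vandermonde factor of the intermediate slice cancels, and the remaining prefactor is
  symmetric in \<open>S\<close> and \<open>t\<close>.\<close>

lemma P_tS_eq_transfer: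
  assumes "X \<in> configs N T S t"
  shows "P_tS N T S t X Z = vandermonde N Z
      / (pochhammer (real T - real t) N * pochhammer (real T - real S) N * vandermonde N X)
    * transfer (\<lambda>i y. two_step_wt N T S t (X i) y (Z i)) X N (\<lambda>_. 1)"
  unfolding sum_configs_eq_transfer[OF assms, symmetric] sum_distrib_left P_tS_eq Suc_eq_plus1[symmetric]
proof (intro sum.cong refl)
  fix Y assume "Y \<in> configs N T S (Suc t)"
  then have "vandermonde N Y \<noteq> 0"
    using vandermonde_pos[of N Y] by (auto simp: configs_def)
  then show "P_t_plus N T S t X Y * P_t_plus N T (Suc t) S Y Z = vandermonde N Z
      / (pochhammer (real T - real t) N * pochhammer (real T - real S) N * vandermonde N X)
    * (\<Prod>i\<in>{1..N}. two_step_wt N T S t (X i) (Y i) (Z i))"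
    by (simp add: P_t_plus_eq two_step_wt_def prod.distrib mult_ac)
qed

lemma P_tS_commute:
  assumes "1 \<le> N" "X \<in> configs N T S t" "Z \<in> configs N T (Suc S) (Suc t)"
  shows "P_tS N T S t X Z = P_tS N T t S X Z"
proof -
  have "transfer (\<lambda>i y. two_step_wt N T S t (X i) y (Z i)) X N (\<lambda>_. 1)
      = transfer (\<lambda>i y. two_step_wt N T t S (X i) y (Z i)) X N (\<lambda>_. 1)"
    by (rule transfer_commute) (use assms in \<open>auto simp: configs_def\<close>)
  then show ?thesis
    using assms(2) by (simp add: P_tS_eq_transfer configs_commute mult.commute)
qed

section \<open>Signs of the two-step kernel\<close>

lemma P_S_plus_nonneg:
  assumes "S < T" "X \<in> configs N T S t" "Y \<in> configs N T (Suc S) t"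
  shows "P_S_plus N T S t X Y \<ge> 0"
  using P_t_plus_nonneg[of S T X N t Y] assms by (simp add: P_S_plus_eq_P_t_plus configs_commute)

lemma P_tS_pos:
  assumes "S < T" "t < T" "X \<in> configs N T S t" "Y \<in> configs N T S (Suc t)"
    "Z \<in> configs N T (Suc S) (Suc t)"
    and "P_t_plus N T S t X Y > 0" "P_S_plus N T S (Suc t) Y Z > 0"
  shows "P_tS N T S t X Z > 0"
  unfolding P_tS_def matrix_prod_def Suc_eq_plus1[symmetric]
  by (rule sum_pos2[OF finite_configs assms(4)])
     (use assms in \<open>auto intro!: mult_nonneg_nonneg intro: P_t_plus_nonneg P_S_plus_nonneg\<close>)

lemma P_tS_nonneg:
  assumes "S < T" "t < T" "X \<in> configs N T S t" "Z \<in> configs N T (Suc S) (Suc t)"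
  shows "P_tS N T S t X Z \<ge> 0"
  unfolding P_tS_def matrix_prod_def Suc_eq_plus1[symmetric]
  by (intro sum_nonneg mult_nonneg_nonneg) (use assms in \<open>auto intro: P_t_plus_nonneg P_S_plus_nonneg\<close>)

subsection \<open>Families of paths\<close>

lemma strict_mono_on_packed:
  fixes X :: config
  assumes mono: "strict_mono_on {1..N} X" and range: "\<And>i. i \<in> {1..N} \<Longrightarrow> X i \<in> {a..a + int N - 1}"
    and "i \<in> {1..N}"
  shows "X i = a + int i - 1"
proof (rule antisym)
  have "1 \<le> i" "i \<le> N" using assms(3) by auto
  from this(1,2) show "a + int i - 1 \<le> X i"
  proof (induction i rule: dec_induct)
    case base
    then show ?case using range[of 1] by simp
  next
    case (step j)
    then have "X j < X (Suc j)" using mono by (auto simp: strict_mono_on_def)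
    then show ?case using step by simp
  qed
  from \<open>i \<le> N\<close> \<open>1 \<le> i\<close> show "X i \<le> a + int i - 1"
  proof (induction i rule: inc_induct)
    case base
    then show ?case using range[of N] by simp
  next
    case (step j)
    then have "X j < X (Suc j)" using mono by (auto simp: strict_mono_on_def)
    then show ?case using step by simp
  qed
qed

lemma configs_packed:
  assumes "sites N T S t = {a..a + int N - 1}"
  shows "configs N T S t = {\<lambda>i\<in>{1..N}. a + int i - 1}"
proof -
  have "X = (\<lambda>i\<in>{1..N}. a + int i - 1)" if "X \<in> configs N T S t" for X
  proof (rule extensionalityI[where A = "{1..N}"])
    fix i assume i: "i \<in> {1..N}"
    have "X j \<in> {a..a + int N - 1}" if "j \<in> {1..N}" for j
      using \<open>X \<in> configs N T S t\<close> that unfolding configs_def assms by blast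
    with that i show "X i = (\<lambda>i\<in>{1..N}. a + int i - 1) i"
      using strict_mono_on_packed[of N X a i] by (simp add: configs_def)
  qed (use that in \<open>auto simp: configs_def PiE_def\<close>)
  moreover have "(\<lambda>i\<in>{1..N}. a + int i - 1) \<in> configs N T S t"
    by (auto simp: configs_def assms strict_mono_on_def)
  ultimately show ?thesis by blast
qed

lemma configs_start: "S \<le> T \<Longrightarrow> configs N T S 0 = {\<lambda>i\<in>{1..N}. int i - 1}"
  by (subst configs_packed[of _ _ _ _ 0]) (auto simp: sites_def)

lemma configs_end: "S \<le> T \<Longrightarrow> configs N T S T = {\<lambda>i\<in>{1..N}. int S + int i - 1}"
  by (subst configs_packed[of _ _ _ _ "int S"]) (auto simp: sites_def)

lemma vandermonde_translate:
  assumes "\<And>i. i \<in> {1..N} \<Longrightarrow> Y i = X i + c"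
  shows "vandermonde N Y = vandermonde N X"
  unfolding vandermonde_def by (intro prod.cong) (auto simp: assms)

text \<open>All particles stay, and their weights \<open>T - S + i - 1\<close> are the factors of
  the Pochhammer symbol in increasing order.\<close>

lemma P_S_plus_start:
  assumes "S < T" "Y \<in> configs N T S 0" "X \<in> configs N T (Suc S) 0"
  shows "P_S_plus N T S 0 Y X = 1"
proof -
  have eq: "Y = (\<lambda>i\<in>{1..N}. int i - 1)" "X = Y"
    using assms by (simp_all add: configs_start)
  have "vandermonde N Y > 0"
    using assms(2) by (auto simp: configs_def intro: vandermonde_pos)
  moreover have "(\<Prod>i\<in>{1..N}. step_wt N T 0 S (Y i) (X i)) = pochhammer (real T - real S) N"
    unfolding pochhammer_prod
    by (rule prod.reindex_bij_witness[of _ Suc "\<lambda>i. i - 1"]) (auto simp: step_wt_def eq)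
  moreover have "pochhammer (real T - real S) N > 0"
    using assms by (intro pochhammer_pos) auto
  ultimately show ?thesis
    by (simp add: P_S_plus_eq_P_t_plus P_t_plus_eq eq(2))
qed

text \<open>All particles move, and their weights \<open>T - S + N - i\<close> run through the same
  factors in decreasing order.\<close>

lemma P_S_plus_end:
  assumes "S < T" "Y \<in> configs N T S T" "X \<in> configs N T (Suc S) T"
  shows "P_S_plus N T S T Y X = 1"
proof -
  have eq: "Y = (\<lambda>i\<in>{1..N}. int S + int i - 1)" "X = (\<lambda>i\<in>{1..N}. int S + int i)"
    using assms by (simp_all add: configs_end)
  have "vandermonde N X = vandermonde N Y"
    by (rule vandermonde_translate[of N _ _ 1]) (simp add: eq)
  moreover have "vandermonde N Y > 0"
    using assms(2) by (auto simp: configs_def intro: vandermonde_pos)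
  moreover have "(\<Prod>i\<in>{1..N}. step_wt N T T S (Y i) (X i)) = pochhammer (real T - real S) N"
    unfolding pochhammer_prod
    by (rule prod.reindex_bij_witness[of _ "\<lambda>k. N - k" "\<lambda>i. N - i"]) (auto simp: step_wt_def eq of_nat_diff)
  moreover have "pochhammer (real T - real S) N > 0"
    using assms by (intro pochhammer_pos) auto
  ultimately show ?thesis
    by (simp add: P_S_plus_eq_P_t_plus P_t_plus_eq)
qed

lemma path_bounds:
  fixes x :: "nat \<Rightarrow> int"
  assumes "\<And>t. t < n \<Longrightarrow> x (Suc t) - x t \<in> {0, 1}" "s \<le> t" "t \<le> n"
  shows "x s \<le> x t \<and> x t \<le> x s + int (t - s)"
  using assms(2,3)
proof (induction t rule: dec_induct)
  case (step t)
  then show ?case using assms(1)[of t] by (auto simp: of_nat_diff)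
qed simp

text \<open>The end conditions are absorbed by the slices, which are forced at times 0 and
  \<open>T\<close>; conversely \<open>path_bounds\<close> from both ends yields the site bounds.
  This form matches the product sets of \<open>sum_paths_forward\<close> and
  \<open>sum_paths_backward\<close>.\<close>

lemma Omega_eq:
  assumes "S \<le> T"
  shows "Omega N T S = {X \<in> PiE {0..T} (configs N T S).
    \<forall>t<T. \<forall>i\<in>{1..N}. X (Suc t) i - X t i \<in> {0, 1}}"
proof (intro equalityI subsetI CollectI conjI)
  fix X assume X: "X \<in> Omega N T S"
  show "\<forall>t<T. \<forall>i\<in>{1..N}. X (Suc t) i - X t i \<in> {0, 1}"
    using X by (auto simp: Omega_def)
  have "X t \<in> configs N T S t" if "t \<le> T" for t
  proof -
    have "X t i \<in> sites N T S t" if i: "i \<in> {1..N}" for i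
      using path_bounds[of T "\<lambda>t. X t i" 0 t] path_bounds[of T "\<lambda>t. X t i" t T] X i \<open>t \<le> T\<close>
      by (force simp: Omega_def sites_def of_nat_diff)
    then show ?thesis
      using X that by (auto simp: Omega_def configs_def PiE_def Pi_def)
  qed
  then show "X \<in> PiE {0..T} (configs N T S)"
    using X by (auto simp: Omega_def PiE_def Pi_def)
next
  fix X assume X: "X \<in> {X \<in> PiE {0..T} (configs N T S).
    \<forall>t<T. \<forall>i\<in>{1..N}. X (Suc t) i - X t i \<in> {0, 1}}"
  then have conf: "\<And>t. t \<le> T \<Longrightarrow> X t \<in> configs N T S t" by auto
  have "\<forall>i\<in>{1..N}. X 0 i = int i - 1" "\<forall>i\<in>{1..N}. X T i = int S + int i - 1"
    using conf[of 0] conf[of T] assms by (simp_all add: configs_start configs_end)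
  then show "X \<in> Omega N T S"
    using X conf by (auto simp: Omega_def configs_def PiE_def Pi_def)
qed

lemma finite_Omega: "S \<le> T \<Longrightarrow> finite (Omega N T S)"
  by (rule finite_subset[of _ "PiE {0..T} (configs N T S)"])
     (auto simp: Omega_eq finite_configs intro!: finite_PiE)

text \<open>Being constant on \<open>Omega N T S\<close> (\<open>path_wt_eq\<close>), this weight
  can stand for the uniform one, and its factors recombine with those of
  \<open>P_down\<close>.\<close>

definition path_wt :: "nat \<Rightarrow> nat \<Rightarrow> nat \<Rightarrow> family \<Rightarrow> real" where
  "path_wt N T S X = (\<Prod>t<T. P_t_plus N T S t (X t) (X (Suc t)))"

lemma path_wt_pos:
  assumes "S \<le> T" "X \<in> Omega N T S"
  shows "path_wt N T S X > 0"
  unfolding path_wt_def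
proof (intro prod_pos ballI)
  fix t assume "t \<in> {..<T}"
  then show "P_t_plus N T S t (X t) (X (Suc t)) > 0"
    using assms by (subst P_t_plus_pos_iff) (auto simp: Omega_eq PiE_mem)
qed

text \<open>The up-steps of a path visit each site between its end points once, and its flat steps
  visit each value of \<open>t - x\<close> once, so the product of the step weights is independent of the path.\<close>

lemma prod_step_wt_path:
  fixes x :: "nat \<Rightarrow> int"
  assumes "\<And>t. t < n \<Longrightarrow> x (Suc t) - x t \<in> {0, 1}"
  shows "(\<Prod>t<n. step_wt N T S t (x t) (x (Suc t)))
    = (\<Prod>k\<in>{x 0..<x n}. real_of_int (int N + int S - k - 1))
      * (\<Prod>k\<in>{- x 0..<int n - x n}. real_of_int (int T - int S - k))"
  using assms
proof (induction n)
  case (Suc n)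
  have IH: "(\<Prod>t<n. step_wt N T S t (x t) (x (Suc t)))
    = (\<Prod>k\<in>{x 0..<x n}. real_of_int (int N + int S - k - 1))
      * (\<Prod>k\<in>{- x 0..<int n - x n}. real_of_int (int T - int S - k))"
    using Suc by simp
  have bounds: "x 0 \<le> x n" "x n \<le> x 0 + int n"
    using path_bounds[of n x 0 n] Suc.prems by auto
  consider "x (Suc n) = x n" | "x (Suc n) = x n + 1"
    using Suc.prems[of n] by force
  then show ?case
  proof cases
    case 1
    have "{- x 0..<int (Suc n) - x (Suc n)} = insert (int n - x n) {- x 0..<int n - x n}"
      using bounds 1 by auto
    moreover have "step_wt N T S n (x n) (x (Suc n)) = real_of_int (int T - int S - (int n - x n))"
      using 1 by (simp add: step_wt_def)
    ultimately show ?thesis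
      unfolding prod.lessThan_Suc IH 1 by simp
  next
    case 2
    have "{x 0..<x (Suc n)} = insert (x n) {x 0..<x n}"
      using bounds 2 by auto
    moreover have "step_wt N T S n (x n) (x (Suc n)) = real_of_int (int N + int S - x n - 1)"
      using 2 by (simp add: step_wt_def)
    ultimately show ?thesis
      unfolding prod.lessThan_Suc IH using 2 by simp
  qed
qed simp

text \<open>The Vandermonde ratios telescope, and the step weights of each path depend only on its
  end points, which all families share.\<close>

lemma path_wt_eq:
  assumes "S \<le> T" "X \<in> Omega N T S" "X' \<in> Omega N T S"
  shows "path_wt N T S X = path_wt N T S X'"
proof -
  define c where "c = (\<Prod>t<T. inverse (pochhammer (real T - real t) N))"
  have path_wt: "path_wt N T S X = c * (vandermonde N (X T) / vandermonde N (X 0)) *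
    (\<Prod>i\<in>{1..N}. (\<Prod>k\<in>{X 0 i..<X T i}. real_of_int (int N + int S - k - 1))
      * (\<Prod>k\<in>{- X 0 i..<int T - X T i}. real_of_int (int T - int S - k)))"
    if X: "X \<in> Omega N T S" for X
  proof -
    have conf: "X t \<in> configs N T S t" if "t \<le> T" for t
      using X assms that by (auto simp: Omega_eq)
    have V: "vandermonde N (X t) \<noteq> 0" if "t \<le> T" for t
      using vandermonde_pos[of N "X t"] conf[OF that] by (auto simp: configs_def)
    have tele: "(\<Prod>t<n. vandermonde N (X (Suc t)) / vandermonde N (X t))
        = vandermonde N (X n) / vandermonde N (X 0)" if "n \<le> T" for n
      using that by (induction n) (use V in \<open>auto simp: field_simps\<close>)
    have "path_wt N T S X = (\<Prod>t<T. inverse (pochhammer (real T - real t) N)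
        * (vandermonde N (X (Suc t)) / vandermonde N (X t))
        * (\<Prod>i\<in>{1..N}. step_wt N T S t (X t i) (X (Suc t) i)))"
      unfolding path_wt_def P_t_plus_eq by (simp add: field_simps)
    also have "\<dots> = c * (vandermonde N (X T) / vandermonde N (X 0)) *
        (\<Prod>i\<in>{1..N}. \<Prod>t<T. step_wt N T S t (X t i) (X (Suc t) i))"
      unfolding prod.distrib c_def tele[OF order_refl] by (subst (2) prod.swap) simp
    also have "(\<Prod>i\<in>{1..N}. \<Prod>t<T. step_wt N T S t (X t i) (X (Suc t) i)) =
      (\<Prod>i\<in>{1..N}. (\<Prod>k\<in>{X 0 i..<X T i}. real_of_int (int N + int S - k - 1))
      * (\<Prod>k\<in>{- X 0 i..<int T - X T i}. real_of_int (int T - int S - k)))"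
      by (intro prod.cong refl prod_step_wt_path) (use X assms in \<open>auto simp: Omega_eq\<close>)
    finally show ?thesis .
  qed
  have "X 0 \<in> configs N T S 0" "X' 0 \<in> configs N T S 0" "X T \<in> configs N T S T" "X' T \<in> configs N T S T"
    using assms by (auto simp: Omega_eq)
  then have "X 0 = X' 0" "X T = X' T"
    using assms(1) by (simp_all add: configs_start configs_end)
  then show ?thesis
    using path_wt[OF assms(2)] path_wt[OF assms(3)] by simp
qed

subsection \<open>Row and column sums\<close>

text \<open>If the product of denominators is not positive, nonnegativity forces one of them to be
  0. As \<open>x / 0 = 0\<close>, the product of quotients then agrees with the default value of
  \<open>P_down\<close>.\<close>

lemma P_down_Suc_eq:
  assumes "S < T" "X \<in> Omega N T (Suc S)" "Y \<in> Omega N T S"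
  shows "P_down N T (Suc S) X Y = (\<Prod>t<T. P_t_plus N T S t (Y t) (Y (Suc t))
    * P_S_plus N T S (Suc t) (Y (Suc t)) (X (Suc t)) / P_tS N T S t (Y t) (X (Suc t)))"
proof (cases "(\<Prod>t<T. P_tS N T S t (Y t) (X (Suc t))) > 0")
  case True
  then show ?thesis by (simp add: P_down_def lessThan_atLeast0)
next
  case False
  have "P_tS N T S t (Y t) (X (Suc t)) \<ge> 0" if "t < T" for t
    using assms that by (intro P_tS_nonneg) (auto simp: Omega_eq)
  moreover have "\<exists>t<T. \<not> P_tS N T S t (Y t) (X (Suc t)) > 0"
    using False by (auto intro: prod_pos)
  ultimately obtain t where "t < T" "P_tS N T S t (Y t) (X (Suc t)) = 0"
    by force
  then have "(\<Prod>t<T. P_t_plus N T S t (Y t) (Y (Suc t))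
    * P_S_plus N T S (Suc t) (Y (Suc t)) (X (Suc t)) / P_tS N T S t (Y t) (X (Suc t))) = 0"
    by (intro prod_zero) auto
  then show ?thesis using False by (simp add: P_down_def lessThan_atLeast0)
qed

lemma P_down_nonneg:
  assumes "S < T" "X \<in> Omega N T (Suc S)" "Y \<in> Omega N T S"
  shows "P_down N T (Suc S) X Y \<ge> 0"
  unfolding P_down_Suc_eq[OF assms]
proof (intro prod_nonneg ballI)
  fix t assume "t \<in> {..<T}"
  then show "0 \<le> P_t_plus N T S t (Y t) (Y (Suc t))
      * P_S_plus N T S (Suc t) (Y (Suc t)) (X (Suc t)) / P_tS N T S t (Y t) (X (Suc t))"
    using assms by (intro divide_nonneg_nonneg mult_nonneg_nonneg P_t_plus_nonneg
        P_S_plus_nonneg P_tS_nonneg) (auto simp: Omega_eq)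
qed

text \<open>This confines the later sums to slices where the denominators are positive. Time 0
  contributes no factor to \<open>P_down\<close> and is covered by
  \<open>P_S_plus_start\<close>.\<close>

lemma P_down_nonzero_imp_P_S_plus_pos:
  assumes "S < T" "X \<in> Omega N T (Suc S)" "Y \<in> Omega N T S" "P_down N T (Suc S) X Y \<noteq> 0"
    and "t \<le> T"
  shows "P_S_plus N T S t (Y t) (X t) > 0"
proof (cases t)
  case 0
  have "Y 0 \<in> configs N T S 0" "X 0 \<in> configs N T (Suc S) 0"
    using assms by (auto simp: Omega_eq)
  with 0 show ?thesis
    by (simp add: P_S_plus_start[OF assms(1)])
next
  case (Suc k)
  have "Y t \<in> configs N T S t" "X t \<in> configs N T (Suc S) t"
    using assms by (auto simp: Omega_eq)
  then have "P_S_plus N T S t (Y t) (X t) \<ge> 0"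
    by (rule P_S_plus_nonneg[OF assms(1)])
  moreover have "P_S_plus N T S t (Y t) (X t) \<noteq> 0"
    using assms(4,5) Suc unfolding P_down_Suc_eq[OF assms(1-3)] by auto
  ultimately show ?thesis by simp
qed

text \<open>The factor at \<open>t\<close> is the conditional law of \<open>Y (Suc t)\<close> given
  \<open>Y t\<close> and \<open>X (Suc t)\<close>, which sums to one once its denominator is
  positive; \<open>G t\<close> collects the slices for which this holds.\<close>

lemma sum_P_down:
  assumes "1 \<le> N" "S < T" "X \<in> Omega N T (Suc S)"
  shows "(\<Sum>Y\<in>Omega N T S. P_down N T (Suc S) X Y) = 1"
proof -
  define G where "G t = {y \<in> configs N T S t. P_S_plus N T S t y (X t) > 0}" for t
  define q where "q t a b = P_t_plus N T S t a b * P_S_plus N T S (Suc t) b (X (Suc t))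
      / P_tS N T S t a (X (Suc t))" for t a b
  have X: "X t \<in> configs N T (Suc S) t" if "t \<le> T" for t
    using assms that by (auto simp: Omega_eq)
  have step: "(\<Sum>b\<in>G (Suc t). q t a b) = 1" if "t < T" "a \<in> G t" for t a
  proof -
    have "P_t_plus N T (Suc S) t (X t) (X (Suc t)) > 0"
      using that assms by (subst P_t_plus_pos_iff) (auto simp: Omega_eq)
    \<comment> \<open>The route from \<open>a\<close> via \<open>X t\<close> to
      \<open>X (Suc t)\<close> is possible but takes the \<open>S\<close>-step first; commutation
      carries positivity over to the order in the denominator.\<close>
    then have "P_tS N T t S a (X (Suc t)) > 0"
      using that assms(2) X[of t] X[of "Suc t"]
      by (intro P_tS_pos[where Y = "X t"])
         (auto simp: G_def configs_commute P_S_plus_eq_P_t_plus)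
    then have "P_tS N T S t a (X (Suc t)) > 0"
      using that P_tS_commute[OF assms(1), of a T S t "X (Suc t)"] X[of "Suc t"] by (simp add: G_def)
    moreover have "(\<Sum>b\<in>G (Suc t). q t a b) = (\<Sum>b\<in>configs N T S (Suc t). q t a b)"
    proof (rule sum.mono_neutral_left[OF finite_configs])
      show "\<forall>b\<in>configs N T S (Suc t) - G (Suc t). q t a b = 0"
        using P_S_plus_nonneg[OF assms(2) _ X[of "Suc t"]] that
        by (force simp: G_def q_def)
    qed (auto simp: G_def)
    ultimately show ?thesis
      by (simp add: q_def P_tS_def matrix_prod_def flip: sum_divide_distrib)
  qed
  have P_down: "P_down N T (Suc S) X Y = (\<Prod>t<T. q t (Y t) (Y (Suc t)))" if "Y \<in> Omega N T S" for Y
    unfolding P_down_Suc_eq[OF assms(2,3) that] q_def ..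
  have "(\<Sum>Y\<in>Omega N T S. P_down N T (Suc S) X Y)
      = (\<Sum>Y\<in>PiE {0..T} G. \<Prod>t<T. q t (Y t) (Y (Suc t)))"
  proof (rule sum.mono_neutral_cong)
    show "finite (PiE {0..T} G)"
      by (intro finite_PiE) (auto simp: G_def finite_configs)
  next
    fix Y assume Y: "Y \<in> Omega N T S - PiE {0..T} G"
    then have "Y \<in> PiE {0..T} (configs N T S)"
      using assms(2) by (simp add: Omega_eq)
    then show "P_down N T (Suc S) X Y = 0"
      using P_down_nonzero_imp_P_S_plus_pos[OF assms(2,3), of Y] Y
      by (auto simp: G_def PiE_def Pi_def)
  next
    fix Y assume Y: "Y \<in> PiE {0..T} G - Omega N T S"
    then have "Y \<in> PiE {0..T} (configs N T S)"
      by (auto simp: G_def PiE_def Pi_def)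
    with Y assms(2) obtain t where "t < T" "\<not> (\<forall>i\<in>{1..N}. Y (Suc t) i - Y t i \<in> {0, 1})"
      by (auto simp: Omega_eq)
    then show "(\<Prod>t<T. q t (Y t) (Y (Suc t))) = 0"
      by (intro prod_zero) (auto simp: q_def P_t_plus_def)
  qed (use assms P_down in \<open>auto simp: finite_Omega\<close>)
  also have "\<dots> = card (G 0)"
    by (rule sum_paths_forward[of T G q, OF step])
  also have "G 0 = configs N T S 0"
    using P_S_plus_start[OF assms(2) _ X[of 0]] by (auto simp: G_def)
  finally show ?thesis
    using assms(2) by (simp add: configs_start)
qed

text \<open>Against the path weights, commutativity turns \<open>P_down\<close> into the transition weights of
  the family \<open>X\<close> run backwards from \<open>X(T)\<close>, so that the sum is taken over \<open>X(0), X(1), \<dots>\<close> in turn.\<close>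

lemma sum_P_down_path_wt:
  assumes "1 \<le> N" "S < T" "Y \<in> Omega N T S"
  shows "(\<Sum>X\<in>Omega N T (Suc S). P_down N T (Suc S) X Y * path_wt N T (Suc S) X) = path_wt N T S Y"
proof -
  define H where "H t = {x \<in> configs N T (Suc S) t. P_S_plus N T S t (Y t) x > 0}" for t
  define r where "r t a b = P_S_plus N T S t (Y t) a * P_t_plus N T (Suc S) t a b
      / P_tS N T S t (Y t) b" for t a b
  have Y: "Y t \<in> configs N T S t" if "t \<le> T" for t
    using assms that by (auto simp: Omega_eq)
  have step: "(\<Sum>a\<in>H t. r t a b) = 1" if "t < T" "b \<in> H (Suc t)" for t b
  proof -
    \<comment> \<open>No commutation is involved in this positivity: the route via
      \<open>Y (Suc t)\<close> already has the order of the denominator.\<close>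
    have "P_t_plus N T S t (Y t) (Y (Suc t)) > 0"
      using that assms by (subst P_t_plus_pos_iff) (auto simp: Omega_eq)
    then have pos: "P_tS N T S t (Y t) b > 0"
      using that assms(2) Y[of t] Y[of "Suc t"]
      by (intro P_tS_pos[where Y = "Y (Suc t)"]) (auto simp: H_def)
    have "(\<Sum>a\<in>H t. r t a b) = (\<Sum>a\<in>configs N T (Suc S) t. r t a b)"
    proof (rule sum.mono_neutral_left[OF finite_configs])
      show "\<forall>a\<in>configs N T (Suc S) t - H t. r t a b = 0"
        using P_S_plus_nonneg[OF assms(2) Y[of t]] that
        by (force simp: H_def r_def)
    qed (auto simp: H_def)
    also have "\<dots> = P_tS N T t S (Y t) b / P_tS N T S t (Y t) b"
      by (simp add: r_def P_tS_eq P_S_plus_eq_P_t_plus configs_commute[of N T "Suc S"]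
          flip: sum_divide_distrib)
    also have "P_tS N T t S (Y t) b = P_tS N T S t (Y t) b"
      using that P_tS_commute[OF assms(1), of "Y t" T S t b] Y[of t] by (simp add: H_def)
    finally show ?thesis using pos by simp
  qed
  have summand: "P_down N T (Suc S) X Y * path_wt N T (Suc S) X
      = path_wt N T S Y * (\<Prod>t<T. r t (X t) (X (Suc t)))" if "X \<in> Omega N T (Suc S)" for X
  proof -
    define p where "p t = P_S_plus N T S t (Y t) (X t)" for t
    have "X 0 \<in> configs N T (Suc S) 0" "X T \<in> configs N T (Suc S) T"
      using that assms(2) by (auto simp: Omega_eq)
    then have "p 0 = 1" "p T = 1"
      using Y[of 0] Y[of T] assms(2) by (simp_all add: p_def P_S_plus_start P_S_plus_end)
    \<comment> \<open>The \<open>P_S_plus\<close> factors occur at times 1 to \<open>T\<close> in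
      \<open>P_down\<close> and at times 0 to \<open>T - 1\<close> in \<open>r\<close>; the two
      boundary values are both 1.\<close>
    then have shift: "(\<Prod>t<T. p (Suc t)) = (\<Prod>t<T. p t)"
      using prod.lessThan_Suc[of p T] prod.lessThan_Suc_shift[of p T] by simp
    show ?thesis
      unfolding P_down_Suc_eq[OF assms(2) that assms(3)] r_def path_wt_def p_def[symmetric]
        prod.distrib prod_dividef shift
      by simp
  qed
  have "(\<Sum>X\<in>Omega N T (Suc S). P_down N T (Suc S) X Y * path_wt N T (Suc S) X)
      = (\<Sum>X\<in>PiE {0..T} H. path_wt N T S Y * (\<Prod>t<T. r t (X t) (X (Suc t))))"
  proof (rule sum.mono_neutral_cong)
    show "finite (PiE {0..T} H)"
      by (intro finite_PiE) (auto simp: H_def finite_configs)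
  next
    fix X assume X: "X \<in> Omega N T (Suc S) - PiE {0..T} H"
    then have "X \<in> PiE {0..T} (configs N T (Suc S))"
      using assms(2) by (simp add: Omega_eq)
    then have "P_down N T (Suc S) X Y = 0"
      using P_down_nonzero_imp_P_S_plus_pos[OF assms(2) _ assms(3), of X] X
      by (auto simp: H_def PiE_def Pi_def)
    then show "P_down N T (Suc S) X Y * path_wt N T (Suc S) X = 0" by simp
  next
    fix X assume X: "X \<in> PiE {0..T} H - Omega N T (Suc S)"
    then have "X \<in> PiE {0..T} (configs N T (Suc S))"
      by (auto simp: H_def PiE_def Pi_def)
    with X assms(2) obtain t where "t < T" "\<not> (\<forall>i\<in>{1..N}. X (Suc t) i - X t i \<in> {0, 1})"
      by (auto simp: Omega_eq)
    then have "(\<Prod>t<T. r t (X t) (X (Suc t))) = 0"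
      by (intro prod_zero) (auto simp: r_def P_t_plus_def)
    then show "path_wt N T S Y * (\<Prod>t<T. r t (X t) (X (Suc t))) = 0" by simp
  qed (use assms summand in \<open>auto simp: finite_Omega\<close>)
  also have "\<dots> = path_wt N T S Y * card (H T)"
    using sum_paths_backward[of T H r "\<lambda>_. 1", OF step] by (simp flip: sum_distrib_left)
  also have "H T = configs N T (Suc S) T"
    using P_S_plus_end[OF assms(2) Y[of T]] by (auto simp: H_def)
  finally show ?thesis
    using assms(2) by (simp add: configs_end)
qed

theorem theorem3p2:
  fixes N T S :: nat
  assumes "1 \<le> N" and "1 \<le> T" and "1 \<le> S" and "S \<le> T"
  shows "stochastic (Omega N T S) (Omega N T (S - 1)) (P_down N T S) \<and>
    (\<forall>Y\<in>Omega N T (S - 1).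
       pmf (mu N T (S - 1)) Y = (\<Sum>X\<in>Omega N T S. P_down N T S X Y * pmf (mu N T S) X))"
proof (intro conjI ballI)
  obtain R where S: "S = Suc R" "R < T"
    using assms by (cases S) auto
  show "stochastic (Omega N T S) (Omega N T (S - 1)) (P_down N T S)"
    using P_down_nonneg sum_P_down assms(1) S by (auto simp: stochastic_def)
  fix Y assume "Y \<in> Omega N T (S - 1)"
  then have Y: "Y \<in> Omega N T R" by (simp add: S)
  let ?A = "Omega N T (Suc R)" and ?B = "Omega N T R"
  have fin: "finite ?A" "finite ?B"
    using S by (simp_all add: finite_Omega)
  have "path_wt N T R Y > 0"
    using path_wt_pos[OF _ Y] S by simp
  \<comment> \<open>An empty sum could not equal the positive weight of \<open>Y\<close>.\<close>
  then have "?A \<noteq> {}"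
    using sum_P_down_path_wt[OF assms(1) S(2) Y] by (metis sum.empty less_irrefl)
  then obtain X where X: "X \<in> ?A" by auto
  \<comment> \<open>Both path weights are constant on their sets, so their ratio is the common value
    of all column sums.\<close>
  define \<rho> where "\<rho> = path_wt N T R Y / path_wt N T (Suc R) X"
  have pos: "path_wt N T (Suc R) X > 0"
    using path_wt_pos[OF _ X] S by simp
  have column: "(\<Sum>X\<in>?A. P_down N T (Suc R) X Y') = \<rho>" if "Y' \<in> ?B" for Y'
  proof -
    have "path_wt N T R Y = path_wt N T R Y'"
      using path_wt_eq[OF _ Y that] S by simp
    also have "\<dots> = (\<Sum>X'\<in>?A. P_down N T (Suc R) X' Y' * path_wt N T (Suc R) X)"
      unfolding sum_P_down_path_wt[OF assms(1) S(2) that, symmetric]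
      using path_wt_eq[OF _ _ X] S by (intro sum.cong) auto
    finally show ?thesis
      using pos by (simp add: \<rho>_def field_simps sum_distrib_left sum_distrib_right)
  qed
  \<comment> \<open>Summing all entries by rows and by columns relates \<open>\<rho>\<close> to the
    two cardinalities.\<close>
  have "real (card ?A) = (\<Sum>X\<in>?A. \<Sum>Y\<in>?B. P_down N T (Suc R) X Y)"
    using sum_P_down[OF assms(1) S(2)] by simp
  also have "\<dots> = \<rho> * card ?B"
    by (subst sum.swap) (simp add: column)
  finally have card: "real (card ?A) = \<rho> * card ?B" .
  have "card ?A > 0" "card ?B > 0"
    using X Y fin by (auto simp: card_gt_0_iff)
  moreover from this have "\<rho> \<noteq> 0"
    using card by auto
  moreover have "pmf (mu N T R) Y = 1 / card ?B"
    using Y fin(2) unfolding mu_def by (subst pmf_of_set) (auto simp: indicator_def)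
  moreover have "pmf (mu N T (Suc R)) X' = 1 / card ?A" if "X' \<in> ?A" for X'
    using that fin(1) unfolding mu_def by (subst pmf_of_set) (auto simp: indicator_def)
  then have "(\<Sum>X\<in>?A. P_down N T (Suc R) X Y * pmf (mu N T (Suc R)) X) = \<rho> / card ?A"
    using column[OF Y] by (simp flip: sum_divide_distrib)
  moreover have "1 / card ?B = \<rho> / card ?A"
    using card calculation(2,3) by simp
  ultimately show "pmf (mu N T (S - 1)) Y = (\<Sum>X\<in>Omega N T S. P_down N T S X Y * pmf (mu N T S) X)"
    by (simp add: S)
qed

end
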